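(* Let $q\ge 2$ and $n\ge 1$ be integers, let $h\in\{0,1,\ldots,n\}$ and $\lambda=\lambda_h=(q-1)n-qh$ (so $h=\frac{(q-1)n-\lambda}{q}$). Let $f:\mathbb{F}_q^n\to\mathbb{C}$ be any function satisfying $\sum_{\beta\in W_1(\alpha)} f(\beta)=\lambda f(\alpha)$ for all $\alpha\in\mathbb{F}_q^n$ (a $\lambda$-function), let $\alpha\in\mathbb{F}_q^n$, and let $I\subseteq\{1,\ldots,n\}$ with $\overline{I}=\{1,\ldots,n\}\setminus I$. Then, as an identity of rational functions in the variables $x,y$, $$(x+(q-1)y)^{h-|\overline{I}|}\, g^{\overline{I},\alpha}_f(x,y) = (x'+(q-1)y')^{h-|I|}\, g^{I,\alpha}_f(x',y'),$$ where $x'=x+(q-2)y$ and $y'=-y$.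
   Context: $\mathbb{F}_q=\{0,1,\ldots,q-1\}$ is the additive group of integers modulo $q$ and $\mathbb{F}_q^n$ its $n$-fold direct product; the $q$-ary $n$-dimensional hypercube is the graph on $\mathbb{F}_q^n$ in which two vertices are adjacent iff they differ in exactly one coordinate. For $\alpha\in\mathbb{F}_q^n$, $s(\alpha)$ is the set of nonzero coordinates of $\alpha$ (its support), and the Hamming distance $\rho(\alpha,\beta)=|s(\alpha-\beta)|$. $W_j(\alpha)$ is the set of vertices at Hamming distance exactly $j$ from $\alpha$. For $I\subseteq\{1,\ldots,n\}$, the face $\Gamma_I(\alpha)=\{\beta\in\mathbb{F}_q^n:\beta_i=\alpha_i\ \forall i\notin I\}$. For a function $f:\mathbb{F}_q^n\to\mathbb{C}$, the $(I,\alpha)$-local weight enumerator of $f$ is the polynomial $$g^{I,\alpha}_f(x,y)=\sum_{\beta\in\Gamma_I(\alpha)} f(\beta)\, y^{|s(\beta-\alpha)|}\,x^{|I|-|s(\beta-\alpha)|}.$$ *)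

theory Defs
  imports
    "HOL-Algebra.Product_Groups"
    "HOL-Computational_Algebra.Polynomial_Factorial"
    Complex_Main
begin

(* Vertices are extensional functions {1..n} -> {0..<q}, with coordinatewise addition modulo q. *)
definition hypercube :: "nat \<Rightarrow> nat \<Rightarrow> (nat \<Rightarrow> int) monoid" where
  "hypercube q n = product_group {1..n} (\<lambda>_. integer_mod_group q)"

definition vec_diff :: "nat \<Rightarrow> nat \<Rightarrow> (nat \<Rightarrow> int) \<Rightarrow> (nat \<Rightarrow> int) \<Rightarrow> nat \<Rightarrow> int" where
  "vec_diff q n \<alpha> \<beta> = \<alpha> \<otimes>\<^bsub>hypercube q n\<^esub> inv\<^bsub>hypercube q n\<^esub> \<beta>"

definition support :: "nat \<Rightarrow> (nat \<Rightarrow> int) \<Rightarrow> nat set" where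
  "support n \<alpha> = {i \<in> {1..n}. \<alpha> i \<noteq> 0}"

definition hamming_dist :: "nat \<Rightarrow> nat \<Rightarrow> (nat \<Rightarrow> int) \<Rightarrow> (nat \<Rightarrow> int) \<Rightarrow> nat" where
  "hamming_dist q n \<alpha> \<beta> = card (support n (vec_diff q n \<alpha> \<beta>))"

definition hamming_sphere :: "nat \<Rightarrow> nat \<Rightarrow> nat \<Rightarrow> (nat \<Rightarrow> int) \<Rightarrow> (nat \<Rightarrow> int) set" where
  "hamming_sphere q n j \<alpha> = {\<beta> \<in> carrier (hypercube q n). hamming_dist q n \<alpha> \<beta> = j}"

definition face :: "nat \<Rightarrow> nat \<Rightarrow> nat set \<Rightarrow> (nat \<Rightarrow> int) \<Rightarrow> (nat \<Rightarrow> int) set" where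
  "face q n I \<alpha> = {\<beta> \<in> carrier (hypercube q n). \<forall>i \<in> {1..n} - I. \<beta> i = \<alpha> i}"

definition lambda_function :: "nat \<Rightarrow> nat \<Rightarrow> complex \<Rightarrow> ((nat \<Rightarrow> int) \<Rightarrow> complex) \<Rightarrow> bool" where
  "lambda_function q n \<mu> f \<longleftrightarrow>
     (\<forall>\<alpha> \<in> carrier (hypercube q n). (\<Sum>\<beta> \<in> hamming_sphere q n 1 \<alpha>. f \<beta>) = \<mu> * f \<alpha>)"

(* The polynomial ring C[x,y] is represented as C[x][y]: the inner variable is x, the outer one y. *)

definition bivar_const :: "complex \<Rightarrow> complex poly poly" where
  "bivar_const c = [:[:c:]:]"

definition var_x :: "complex poly poly" where
  "var_x = [:[:0, 1:]:]"

definition var_y :: "complex poly poly" where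
  "var_y = [:0, 1:]"

(* p(u, v), the result of substituting u for x and v for y in p. *)
definition subst_xy :: "complex poly poly \<Rightarrow> complex poly poly \<Rightarrow> complex poly poly \<Rightarrow> complex poly poly" where
  "subst_xy p u v = poly (map_poly (\<lambda>c. poly (map_poly bivar_const c) u) p) v"

definition local_weight_enumerator ::
    "nat \<Rightarrow> nat \<Rightarrow> ((nat \<Rightarrow> int) \<Rightarrow> complex) \<Rightarrow> nat set \<Rightarrow> (nat \<Rightarrow> int) \<Rightarrow> complex poly poly" where
  "local_weight_enumerator q n f I \<alpha> =
     (\<Sum>\<beta> \<in> face q n I \<alpha>.
        bivar_const (f \<beta>) * var_y ^ card (support n (vec_diff q n \<beta> \<alpha>))
          * var_x ^ (card I - card (support n (vec_diff q n \<beta> \<alpha>))))"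

end

theory Submission
  imports Defs
begin

text \<open>
  Let \<open>T\<^sub>i f \<beta>\<close> be the sum of \<open>f\<close> over the line through \<open>\<beta>\<close> in direction \<open>i\<close>.  The operators \<open>T\<^sub>i\<close> commute
  and \<open>T\<^sub>i\<^sup>2 = q T\<^sub>i\<close>, so every \<open>\<lambda>\<close>-function is a sum of \<open>\<lambda>\<close>-functions that are joint eigenfunctions, with
  eigenvalue \<open>0\<close> in the directions of some set \<open>S\<close> and \<open>q\<close> in the others.  Since the adjacency operator is
  \<open>\<Sum>i. (T\<^sub>i - 1)\<close>, a nonzero such component has \<open>card S = h\<close>.  On it the local weight enumerator factors
  over the coordinates as \<open>f \<alpha> * (x - y) ^ card (I \<inter> S) * (x + (q - 1) y) ^ card (I - S)\<close>, and the
  substitution \<open>x' = x + (q - 2) y\<close>, \<open>y' = - y\<close> interchanges \<open>x - y\<close> and \<open>x + (q - 1) y\<close>.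
\<close>

section \<open>Coordinates of the hypercube\<close>

lemma carrier_hypercube:
  assumes "q \<ge> 1"
  shows "carrier (hypercube q n) = (\<Pi>\<^sub>E i\<in>{1..n}. {0..<int q})"
  using assms by (simp add: hypercube_def carrier_integer_mod_group)

lemma finite_carrier_hypercube:
  assumes "q \<ge> 1"
  shows "finite (carrier (hypercube q n))"
  unfolding carrier_hypercube[OF assms] by (rule finite_PiE) auto

lemma fun_upd_in_hypercube:
  assumes "q \<ge> 1" "\<beta> \<in> carrier (hypercube q n)" "i \<in> {1..n}" "a \<in> {0..<int q}"
  shows "\<beta>(i := a) \<in> carrier (hypercube q n)"
  using assms unfolding carrier_hypercube[OF assms(1)] by (auto simp: PiE_iff extensional_def)

lemma hypercube_range:
  assumes "q \<ge> 1" "\<beta> \<in> carrier (hypercube q n)" "i \<in> {1..n}"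
  shows "\<beta> i \<in> {0..<int q}"
  using assms unfolding carrier_hypercube[OF assms(1)] by (rule_tac PiE_mem)

lemma hypercube_eqI:
  assumes "q \<ge> 1" "\<alpha> \<in> carrier (hypercube q n)" "\<beta> \<in> carrier (hypercube q n)"
    and "\<And>i. i \<in> {1..n} \<Longrightarrow> \<alpha> i = \<beta> i"
  shows "\<alpha> = \<beta>"
  using assms unfolding carrier_hypercube[OF assms(1)] by (rule_tac PiE_ext)

lemma vec_diff_eq:
  assumes "q \<ge> 1" "\<beta> \<in> carrier (hypercube q n)" "i \<in> {1..n}"
  shows "vec_diff q n \<alpha> \<beta> i = (\<alpha> i - \<beta> i) mod int q"
proof -
  have \<beta>: "\<beta> \<in> (\<Pi>\<^sub>E i\<in>{1..n}. carrier (integer_mod_group q))"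
    using assms(2) by (simp add: hypercube_def)
  have "\<beta> i \<in> carrier (integer_mod_group q)"
    using PiE_mem[OF \<beta> assms(3)] .
  then show ?thesis
    unfolding vec_diff_def hypercube_def inv_product_group[OF \<beta> group_integer_mod_group]
    using assms(3) by (simp add: mod_simps)
qed

text \<open>Coordinates are representatives in \<open>{0..<int q}\<close>, so a difference of two of
  them is divisible by \<open>q\<close> only when they are equal. This replaces group subtraction by
  plain comparison of coordinates.\<close>

lemma support_vec_diff:
  assumes "q \<ge> 1" "\<alpha> \<in> carrier (hypercube q n)" "\<beta> \<in> carrier (hypercube q n)"
  shows "support n (vec_diff q n \<alpha> \<beta>) = {i \<in> {1..n}. \<alpha> i \<noteq> \<beta> i}"
proof -
  have "(\<alpha> i - \<beta> i) mod int q = 0 \<longleftrightarrow> \<alpha> i = \<beta> i" if "i \<in> {1..n}" for i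
    using hypercube_range[OF assms(1,2) that] hypercube_range[OF assms(1,3) that]
    by (metis atLeastLessThan_iff mod_eq_dvd_iff mod_pos_pos_trivial mod_0_imp_dvd dvd_imp_mod_0)
  then show ?thesis
    unfolding support_def using vec_diff_eq[OF assms(1,3)] by auto
qed

section \<open>Line sums\<close>

text \<open>The line includes the point \<beta> itself, so this is \<open>q\<close> times the
  projection that averages over coordinate \<open>i\<close>. It makes sense for every \<beta>, in
  the hypercube or not, which keeps the algebraic laws below free of membership conditions.\<close>

definition line_sum :: "nat \<Rightarrow> nat \<Rightarrow> ((nat \<Rightarrow> int) \<Rightarrow> complex) \<Rightarrow> (nat \<Rightarrow> int) \<Rightarrow> complex" where
  "line_sum q i f \<beta> = (\<Sum>a\<in>{0..<int q}. f (\<beta>(i := a)))"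

lemma line_sum_line_sum_same: "line_sum q i (line_sum q i f) \<beta> = of_nat q * line_sum q i f \<beta>"
  by (simp add: line_sum_def)

lemma line_sum_commute: "line_sum q i (line_sum q j f) \<beta> = line_sum q j (line_sum q i f) \<beta>"
proof (cases "i = j")
  case False
  then show ?thesis
    unfolding line_sum_def by (subst sum.swap) (simp add: fun_upd_twist)
qed simp

lemma line_sum_divide: "line_sum q i (\<lambda>\<beta>. f \<beta> / c) \<beta> = line_sum q i f \<beta> / c"
  by (simp add: line_sum_def sum_divide_distrib)

lemma line_sum_diff: "line_sum q i (\<lambda>\<beta>. f \<beta> - g \<beta>) \<beta> = line_sum q i f \<beta> - line_sum q i g \<beta>"
  by (simp add: line_sum_def sum_subtractf)

text \<open>Eigenvalue equations are known on the hypercube only. A line through a vertex stays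
  inside it, so such an equation may be used under a further line sum.\<close>

lemma line_sum_cong_scale:
  assumes "q \<ge> 1" "\<And>\<beta>. \<beta> \<in> carrier (hypercube q n) \<Longrightarrow> f \<beta> = c * g \<beta>"
    and "\<beta> \<in> carrier (hypercube q n)" "i \<in> {1..n}"
  shows "line_sum q i f \<beta> = c * line_sum q i g \<beta>"
  unfolding line_sum_def sum_distrib_left
  by (rule sum.cong) (auto intro!: assms(2) fun_upd_in_hypercube[OF assms(1,3,4)])

text \<open>Each neighbour of \<alpha> is \<open>\<alpha>(i := a)\<close> for exactly one pair
  \<open>(i, a)\<close> with \<open>a \<noteq> \<alpha> i\<close>. Each of the \<open>n\<close> line
  sums also counts \<alpha> itself once, hence the correction term.\<close>

lemma sum_hamming_sphere_1:
  assumes q: "q \<ge> 1" and \<alpha>: "\<alpha> \<in> carrier (hypercube q n)"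
  shows "(\<Sum>\<beta>\<in>hamming_sphere q n 1 \<alpha>. f \<beta>) = (\<Sum>i\<in>{1..n}. line_sum q i f \<alpha>) - of_nat n * f \<alpha>"
proof -
  let ?P = "SIGMA i:{1..n}. {0..<int q} - {\<alpha> i}"
  let ?u = "\<lambda>(i, a). \<alpha>(i := a)"
  have dist: "hamming_dist q n \<alpha> \<beta> = card {i \<in> {1..n}. \<alpha> i \<noteq> \<beta> i}"
    if "\<beta> \<in> carrier (hypercube q n)" for \<beta>
    using support_vec_diff[OF q \<alpha> that] by (simp add: hamming_dist_def)
  have inj: "inj_on ?u ?P"
    by (rule inj_onI) (clarsimp, metis fun_upd_apply)
  have img: "?u ` ?P = hamming_sphere q n 1 \<alpha>"
  proof (intro equalityI subsetI)
    fix \<beta> assume "\<beta> \<in> ?u ` ?P"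
    then obtain p where p: "\<beta> = ?u p" "p \<in> ?P"
      by (rule imageE)
    obtain i a where "p = (i, a)"
      by (rule prod.exhaust)
    with p have ia: "i \<in> {1..n}" "a \<in> {0..<int q}" "a \<noteq> \<alpha> i" "\<beta> = \<alpha>(i := a)"
      by simp_all
    have "\<beta> \<in> carrier (hypercube q n)"
      using fun_upd_in_hypercube[OF q \<alpha> ia(1,2)] ia(4) by simp
    moreover have "{j \<in> {1..n}. \<alpha> j \<noteq> \<beta> j} = {i}"
      using ia by auto
    ultimately show "\<beta> \<in> hamming_sphere q n 1 \<alpha>"
      by (simp add: hamming_sphere_def dist)
  next
    fix \<beta> assume "\<beta> \<in> hamming_sphere q n 1 \<alpha>"
    then have \<beta>: "\<beta> \<in> carrier (hypercube q n)" and "card {j \<in> {1..n}. \<alpha> j \<noteq> \<beta> j} = 1"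
      using dist by (auto simp: hamming_sphere_def)
    then obtain i where i: "{j \<in> {1..n}. \<alpha> j \<noteq> \<beta> j} = {i}"
      by (auto simp: card_1_singleton_iff)
    then have i': "i \<in> {1..n}" "\<alpha> i \<noteq> \<beta> i" and other: "\<And>j. j \<in> {1..n} \<Longrightarrow> j \<noteq> i \<Longrightarrow> \<alpha> j = \<beta> j"
      by blast+
    have \<beta>i: "\<beta> i \<in> {0..<int q}"
      using hypercube_range[OF q \<beta> i'(1)] .
    have "\<beta> = \<alpha>(i := \<beta> i)"
      by (rule hypercube_eqI[OF q \<beta> fun_upd_in_hypercube[OF q \<alpha> i'(1) \<beta>i]]) (use other in auto)
    then have "\<beta> = ?u (i, \<beta> i)" "(i, \<beta> i) \<in> ?P"
      using i' \<beta>i by auto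
    then show "\<beta> \<in> ?u ` ?P"
      by (rule image_eqI)
  qed
  have "(\<Sum>\<beta>\<in>hamming_sphere q n 1 \<alpha>. f \<beta>) = (\<Sum>(i, a)\<in>?P. f (\<alpha>(i := a)))"
    unfolding img[symmetric] sum.reindex[OF inj] by (simp add: case_prod_unfold)
  also have "\<dots> = (\<Sum>i\<in>{1..n}. \<Sum>a\<in>{0..<int q} - {\<alpha> i}. f (\<alpha>(i := a)))"
    by (subst sum.Sigma) auto
  also have "\<dots> = (\<Sum>i\<in>{1..n}. line_sum q i f \<alpha> - f \<alpha>)"
    by (rule sum.cong[OF refl])
      (simp add: line_sum_def sum_diff1 hypercube_range[OF q \<alpha>, simplified])
  finally show ?thesis
    by (simp add: sum_subtractf)
qed

text \<open>The constant is \<lambda> + \<open>n\<close>, because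
  \<open>(q - 1) n - q h + n = q (n - h)\<close>.\<close>

lemma lambda_function_line_sum:
  assumes "q \<ge> 1" and "lambda_function q n (of_int ((int q - 1) * int n - int q * int h)) f"
    and "\<beta> \<in> carrier (hypercube q n)"
  shows "(\<Sum>i\<in>{1..n}. line_sum q i f \<beta>) = of_nat q * (of_nat n - of_nat h) * f \<beta>"
  using assms(2)[unfolded lambda_function_def, rule_format, OF assms(3)]
  by (simp only: sum_hamming_sphere_1[OF assms(1,3)]) (simp add: algebra_simps)

section \<open>Decomposition into joint eigenfunctions\<close>

text \<open>The decomposition takes the form of an induction rule, so the components indexed by
  \<open>S\<close> never have to be written down: an additive property need only be checked on joint
  eigenfunctions. Each component keeps the equation for the sum of all line sums.\<close>

lemma eigenfunction_induct:
  fixes P :: "((nat \<Rightarrow> int) \<Rightarrow> complex) \<Rightarrow> bool"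
    and q n :: nat and c :: complex and f :: "(nat \<Rightarrow> int) \<Rightarrow> complex"
  defines "C \<equiv> carrier (hypercube q n)"
  assumes q: "q \<ge> 1"
    and add: "\<And>f g. P f \<Longrightarrow> P g \<Longrightarrow> P (\<lambda>\<beta>. f \<beta> + g \<beta>)"
    and base: "\<And>f S. S \<subseteq> {1..n} \<Longrightarrow>
        (\<And>i \<beta>. i \<in> {1..n} \<Longrightarrow> \<beta> \<in> C \<Longrightarrow> line_sum q i f \<beta> = (if i \<in> S then 0 else of_nat q) * f \<beta>) \<Longrightarrow>
        (\<And>\<beta>. \<beta> \<in> C \<Longrightarrow> (\<Sum>i\<in>{1..n}. line_sum q i f \<beta>) = c * f \<beta>) \<Longrightarrow> P f"
    and total: "\<And>\<beta>. \<beta> \<in> C \<Longrightarrow> (\<Sum>i\<in>{1..n}. line_sum q i f \<beta>) = c * f \<beta>"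
  shows "P f"
proof -
  \<comment> \<open>\<open>R\<close> holds the directions still to be split, \<open>S\<close> those
    already given eigenvalue 0. The claim is wanted for \<open>R = {1..n}\<close>, and at
    \<open>R = {}\<close> the hypothesis \<open>base\<close> applies.\<close>
  have "P f" if "R \<subseteq> {1..n}" "S \<subseteq> {1..n} - R"
    and eig: "\<And>i \<beta>. i \<in> {1..n} - R \<Longrightarrow> \<beta> \<in> C \<Longrightarrow> line_sum q i f \<beta> = (if i \<in> S then 0 else of_nat q) * f \<beta>"
    and tot: "\<And>\<beta>. \<beta> \<in> C \<Longrightarrow> (\<Sum>i\<in>{1..n}. line_sum q i f \<beta>) = c * f \<beta>" for R S f
    using finite_subset[OF that(1) finite_atLeastAtMost] that
  proof (induction R arbitrary: S f rule: finite_induct)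
    case empty
    then show ?case by (intro base[of S f]) auto
  next
    case (insert j R)
    \<comment> \<open>Since \<open>T\<^sub>j / q\<close> is idempotent, \<open>g\<close> is the part
      of \<open>f\<close> with eigenvalue \<open>q\<close> in direction \<open>j\<close>, and
      \<open>f - g\<close> the part with eigenvalue 0. Line sums commute, so both parts inherit the
      other equations of \<open>f\<close>.\<close>
    define g where "g \<beta> = line_sum q j f \<beta> / of_nat q" for \<beta>
    have j: "j \<in> {1..n}"
      using insert.prems(1) by simp
    have fj: "line_sum q j f \<beta> = of_nat q * g \<beta>" for \<beta>
      using q by (simp add: g_def)
    have gj: "line_sum q j g \<beta> = of_nat q * g \<beta>" for \<beta>
      by (simp add: g_def [abs_def] line_sum_divide line_sum_line_sum_same)
    have g_comm: "line_sum q i g \<beta> = line_sum q j (line_sum q i f) \<beta> / of_nat q" for i \<beta>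
      by (simp add: g_def [abs_def] line_sum_divide line_sum_commute[of q i j])
    have g_eig: "line_sum q i g \<beta> = (if i \<in> S then 0 else of_nat q) * g \<beta>"
      if "i \<in> {1..n} - insert j R" "\<beta> \<in> C" for i \<beta>
      unfolding g_comm g_def times_divide_eq_right
      by (subst line_sum_cong_scale[OF q insert.prems(3)[OF that(1)], unfolded C_def])
        (use that j in \<open>auto simp: C_def\<close>)
    have g_tot: "(\<Sum>i\<in>{1..n}. line_sum q i g \<beta>) = c * g \<beta>" if "\<beta> \<in> C" for \<beta>
    proof -
      have "(\<Sum>i\<in>{1..n}. line_sum q i g \<beta>) = line_sum q j (\<lambda>\<beta>. \<Sum>i\<in>{1..n}. line_sum q i f \<beta>) \<beta> / of_nat q"
        unfolding g_comm sum_divide_distrib[symmetric] unfolding line_sum_def[of q j]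
        by (subst sum.swap) (rule refl)
      also have "\<dots> = c * g \<beta>"
        unfolding g_def times_divide_eq_right
        by (subst line_sum_cong_scale[OF q insert.prems(4), unfolded C_def])
          (use that j in \<open>auto simp: C_def\<close>)
      finally show ?thesis .
    qed
    have "P g"
    proof (rule insert.IH[of S])
      fix i \<beta> assume "i \<in> {1..n} - R" "\<beta> \<in> C"
      then show "line_sum q i g \<beta> = (if i \<in> S then 0 else of_nat q) * g \<beta>"
        using g_eig gj insert.prems(2) by (cases "i = j") auto
    qed (use insert.prems g_tot in auto)
    \<comment> \<open>Here direction \<open>j\<close> has eigenvalue 0 and so joins
      \<open>S\<close>; for \<open>g\<close> it stayed outside.\<close>
    moreover have "P (\<lambda>\<beta>. f \<beta> - g \<beta>)"
    proof (rule insert.IH[of "insert j S"])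
      fix i \<beta> assume "i \<in> {1..n} - R" "\<beta> \<in> C"
      then show "line_sum q i (\<lambda>\<beta>. f \<beta> - g \<beta>) \<beta> = (if i \<in> insert j S then 0 else of_nat q) * (f \<beta> - g \<beta>)"
        using g_eig gj fj insert.prems(3)
        by (cases "i = j") (auto simp: line_sum_diff right_diff_distrib)
    next
      fix \<beta> assume "\<beta> \<in> C"
      then show "(\<Sum>i\<in>{1..n}. line_sum q i (\<lambda>\<beta>. f \<beta> - g \<beta>) \<beta>) = c * (f \<beta> - g \<beta>)"
        using g_tot insert.prems(4) by (simp add: line_sum_diff sum_subtractf right_diff_distrib)
    qed (use insert.prems insert.hyps j in auto)
    ultimately have "P (\<lambda>\<beta>. g \<beta> + (f \<beta> - g \<beta>))"
      by (rule add)
    then show ?case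
      by simp
  qed
  from this[of "{1..n}" "{}"] total show ?thesis
    by simp
qed

section \<open>Evaluation of local weight enumerators\<close>

lemma bivar_const_add: "bivar_const (a + b) = bivar_const a + bivar_const b"
  and bivar_const_mult: "bivar_const (a * b) = bivar_const a * bivar_const b"
  and bivar_const_0 [simp]: "bivar_const 0 = 0"
  by (simp_all add: bivar_const_def)

lemma bivar_const_of_nat: "bivar_const (of_nat k) = of_nat k"
  by (simp add: bivar_const_def of_nat_poly)

lemma bivar_const_sum: "bivar_const (sum f A) = (\<Sum>a\<in>A. bivar_const (f a))"
  by (induction A rule: infinite_finite_induct) (simp_all add: bivar_const_add)

text \<open>Serves both levels of \<open>subst_xy\<close>: the inner embedding of constants and the
  outer evaluation of coefficients.\<close>

lemma map_poly_additive:
  assumes "\<phi> 0 = 0" "\<And>a b. \<phi> (a + b) = \<phi> a + \<phi> b"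
  shows "map_poly \<phi> (p + r) = map_poly \<phi> p + map_poly \<phi> r"
  by (rule poly_eqI) (simp add: coeff_map_poly assms)

lemma subst_xy_add: "subst_xy (p + r) u v = subst_xy p u v + subst_xy r u v"
proof -
  have "map_poly (\<lambda>c. poly (map_poly bivar_const c) u) (p + r) =
      map_poly (\<lambda>c. poly (map_poly bivar_const c) u) p + map_poly (\<lambda>c. poly (map_poly bivar_const c) u) r"
    by (rule map_poly_additive) (simp_all add: map_poly_additive bivar_const_add)
  then show ?thesis
    by (simp add: subst_xy_def)
qed

lemma subst_xy_sum: "subst_xy (sum p A) u v = (\<Sum>a\<in>A. subst_xy (p a) u v)"
proof -
  have "subst_xy 0 u v = 0"
    by (simp add: subst_xy_def)
  then show ?thesis
    by (induction A rule: infinite_finite_induct) (simp_all add: subst_xy_add)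
qed

lemma subst_xy_monom: "subst_xy (bivar_const c * var_y ^ k * var_x ^ m) u v = bivar_const c * v ^ k * u ^ m"
proof -
  have x: "var_x ^ m = [:monom 1 m:]"
    by (induction m) (simp_all add: var_x_def monom_Suc)
  have y: "var_y ^ k = monom 1 k"
    by (induction k) (simp_all add: var_y_def monom_Suc)
  have "bivar_const c * var_y ^ k * var_x ^ m = monom (monom c m) k"
    by (simp add: x y bivar_const_def smult_monom)
  then show ?thesis
    by (simp add: subst_xy_def map_poly_monom poly_monom mult_ac)
qed

text \<open>The value of the enumerator at \<open>(u, v)\<close>, with each monomial spread out as a
  product over the coordinates in \<open>I\<close>. In this form the coordinates can be summed out
  one at a time.\<close>

definition enumerator_at ::
    "nat \<Rightarrow> nat \<Rightarrow> ((nat \<Rightarrow> int) \<Rightarrow> complex) \<Rightarrow> nat set \<Rightarrow> (nat \<Rightarrow> int) \<Rightarrow>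
      complex poly poly \<Rightarrow> complex poly poly \<Rightarrow> complex poly poly" where
  "enumerator_at q n f I \<alpha> u v =
     (\<Sum>\<beta>\<in>face q n I \<alpha>. bivar_const (f \<beta>) * (\<Prod>i\<in>I. if \<beta> i = \<alpha> i then u else v))"

lemma subst_xy_local_weight_enumerator:
  assumes q: "q \<ge> 1" and \<alpha>: "\<alpha> \<in> carrier (hypercube q n)" and I: "I \<subseteq> {1..n}"
  shows "subst_xy (local_weight_enumerator q n f I \<alpha>) u v = enumerator_at q n f I \<alpha> u v"
  unfolding local_weight_enumerator_def enumerator_at_def subst_xy_sum subst_xy_monom
proof (rule sum.cong[OF refl])
  fix \<beta> assume \<beta>: "\<beta> \<in> face q n I \<alpha>"
  let ?D = "{i \<in> I. \<beta> i \<noteq> \<alpha> i}"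
  have fin: "finite I"
    using I finite_subset by blast
  \<comment> \<open>A vertex of the face agrees with \<alpha> outside \<open>I\<close>, so the
    exponent of \<open>v\<close> counts disagreements within \<open>I\<close> and that of
    \<open>u\<close> counts agreements.\<close>
  have supp: "support n (vec_diff q n \<beta> \<alpha>) = ?D"
    using \<beta> I support_vec_diff[OF q _ \<alpha>, of \<beta>] by (auto simp: face_def)
  have "{i \<in> I. \<beta> i = \<alpha> i} = I - ?D"
    by auto
  then have "card {i \<in> I. \<beta> i = \<alpha> i} = card I - card ?D"
    using fin by (simp add: card_Diff_subset)
  moreover have "(\<Prod>i\<in>I. if \<beta> i = \<alpha> i then u else v) = u ^ card {i \<in> I. \<beta> i = \<alpha> i} * v ^ card ?D"
    using fin by (simp add: prod.If_cases Int_def Collect_conj_eq[symmetric])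
  ultimately show "bivar_const (f \<beta>) * v ^ card (support n (vec_diff q n \<beta> \<alpha>)) *
        u ^ (card I - card (support n (vec_diff q n \<beta> \<alpha>))) =
      bivar_const (f \<beta>) * (\<Prod>i\<in>I. if \<beta> i = \<alpha> i then u else v)"
    by (simp add: supp mult_ac)
qed

lemma enumerator_at_add:
  "enumerator_at q n (\<lambda>\<beta>. f \<beta> + g \<beta>) I \<alpha> u v = enumerator_at q n f I \<alpha> u v + enumerator_at q n g I \<alpha> u v"
  by (simp add: enumerator_at_def bivar_const_add distrib_right sum.distrib)

lemma face_empty:
  assumes "q \<ge> 1" "\<alpha> \<in> carrier (hypercube q n)"
  shows "face q n {} \<alpha> = {\<alpha>}"
  using assms hypercube_eqI[OF assms(1) _ assms(2)] by (auto simp: face_def)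

text \<open>The larger face is partitioned into \<open>q\<close> parallel faces by the value of
  coordinate \<open>i\<close>; as \<open>i \<notin> I\<close>, that value is constant on each of
  them.\<close>

lemma sum_face_insert:
  assumes q: "q \<ge> 1" and \<alpha>: "\<alpha> \<in> carrier (hypercube q n)" and i: "i \<in> {1..n}" "i \<notin> I"
  shows "(\<Sum>\<beta>\<in>face q n (insert i I) \<alpha>. F \<beta>) =
    (\<Sum>a\<in>{0..<int q}. \<Sum>\<beta>\<in>face q n I (\<alpha>(i := a)). F \<beta>)"
proof -
  have fin: "finite (face q n I \<beta>)" for \<beta>
    using finite_carrier_hypercube[OF q] by (simp add: face_def)
  have "face q n (insert i I) \<alpha> = (\<Union>a\<in>{0..<int q}. face q n I (\<alpha>(i := a)))"
  proof (intro equalityI subsetI)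
    fix \<beta> assume \<beta>: "\<beta> \<in> face q n (insert i I) \<alpha>"
    then have "\<beta> i \<in> {0..<int q}" "\<beta> \<in> face q n I (\<alpha>(i := \<beta> i))"
      using hypercube_range[OF q _ i(1), of \<beta>] by (auto simp: face_def)
    then show "\<beta> \<in> (\<Union>a\<in>{0..<int q}. face q n I (\<alpha>(i := a)))"
      by blast
  qed (auto simp: face_def split: if_splits)
  moreover have "face q n I (\<alpha>(i := a)) \<inter> face q n I (\<alpha>(i := b)) = {}" if "a \<noteq> b" for a b
    using that i by (auto simp: face_def)
  ultimately show ?thesis
    using fin by (simp add: sum.UNION_disjoint)
qed

text \<open>Summing out coordinate \<open>i\<close> acts on \<open>f\<close> as
  \<open>v T\<^sub>i + (u - v)\<close>. Eigenvalue 0 leaves the factor \<open>u - v\<close>,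
  eigenvalue \<open>q\<close> the factor \<open>u + (q - 1) v\<close>.\<close>

lemma enumerator_at_eigenfunction:
  assumes q: "q \<ge> 1" and I: "I \<subseteq> {1..n}" and \<alpha>: "\<alpha> \<in> carrier (hypercube q n)"
    and eig: "\<And>i \<beta>. i \<in> {1..n} \<Longrightarrow> \<beta> \<in> carrier (hypercube q n) \<Longrightarrow>
      line_sum q i f \<beta> = (if i \<in> S then 0 else of_nat q) * f \<beta>"
  shows "enumerator_at q n f I \<alpha> u v =
    bivar_const (f \<alpha>) * (u - v) ^ card (I \<inter> S) * (u + (of_nat q - 1) * v) ^ card (I - S)"
proof -
  let ?w = "\<lambda>i. if i \<in> S then u - v else u + (of_nat q - 1) * v"
  have "finite I"
    using I finite_subset by blast
  then have "enumerator_at q n f I \<alpha> u v = bivar_const (f \<alpha>) * (\<Prod>i\<in>I. ?w i)"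
    using I \<alpha>
  \<comment> \<open>The base point must vary, since peeling off \<open>i\<close> moves it to
    \<open>\<alpha>(i := a)\<close>.\<close>
  proof (induction I arbitrary: \<alpha> rule: finite_induct)
    case empty
    then show ?case
      by (simp add: enumerator_at_def face_empty[OF q])
  next
    case (insert i I)
    then have i: "i \<in> {1..n}" and \<alpha>: "\<alpha> \<in> carrier (hypercube q n)"
      by auto
    let ?F = "\<lambda>a. bivar_const (f (\<alpha>(i := a)))"
    have upd: "\<alpha>(i := a) \<in> carrier (hypercube q n)" if "a \<in> {0..<int q}" for a
      using fun_upd_in_hypercube[OF q \<alpha> i that] .
    have split: "(\<Prod>j\<in>insert i I. if \<beta> j = \<alpha> j then u else v) =
        (if a = \<alpha> i then u else v) * (\<Prod>j\<in>I. if \<beta> j = (\<alpha>(i := a)) j then u else v)"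
      if "\<beta> \<in> face q n I (\<alpha>(i := a))" for a \<beta>
    proof -
      have "\<beta> i = a"
        using that i insert.hyps by (auto simp: face_def)
      moreover have "(\<Prod>j\<in>I. if \<beta> j = \<alpha> j then u else v) =
          (\<Prod>j\<in>I. if \<beta> j = (\<alpha>(i := a)) j then u else v)"
        by (rule prod.cong) (use insert.hyps in auto)
      ultimately show ?thesis
        using insert.hyps by simp
    qed
    have "enumerator_at q n f (insert i I) \<alpha> u v =
        (\<Sum>a\<in>{0..<int q}. (if a = \<alpha> i then u else v) * enumerator_at q n f I (\<alpha>(i := a)) u v)"
      unfolding enumerator_at_def sum_face_insert[OF q \<alpha> i insert.hyps(2)] sum_distrib_left
      by (intro sum.cong refl) (simp only: split mult_ac)
    also have "\<dots> = (\<Sum>a\<in>{0..<int q}. (if a = \<alpha> i then u else v) * ?F a) * (\<Prod>j\<in>I. ?w j)"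
      unfolding sum_distrib_right
      by (intro sum.cong refl) (use insert.IH insert.prems upd in \<open>simp add: mult_ac\<close>)
    \<comment> \<open>Writing the weight \<open>u\<close> of the single term
      \<open>a = \<alpha> i\<close> as \<open>v + (u - v)\<close> completes the rest to a full line
      sum.\<close>
    also have "(\<Sum>a\<in>{0..<int q}. (if a = \<alpha> i then u else v) * ?F a) =
        (\<Sum>a\<in>{0..<int q}. v * ?F a + (if a = \<alpha> i then (u - v) * ?F a else 0))"
      by (intro sum.cong refl) (simp add: algebra_simps)
    also have "\<dots> = v * bivar_const (line_sum q i f \<alpha>) + (u - v) * bivar_const (f \<alpha>)"
      using hypercube_range[OF q \<alpha> i]
      by (simp add: sum.distrib line_sum_def bivar_const_sum sum_distrib_left)
    also have "\<dots> = ?w i * bivar_const (f \<alpha>)"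
      unfolding eig[OF i \<alpha>]
      by (simp add: bivar_const_mult bivar_const_of_nat algebra_simps)
    finally show ?case
      using insert.hyps by (simp add: mult_ac)
  qed
  also have "(\<Prod>i\<in>I. ?w i) = (u - v) ^ card (I \<inter> S) * (u + (of_nat q - 1) * v) ^ card (I - S)"
    using \<open>finite I\<close> by (simp add: prod.If_cases Diff_eq)
  finally show ?thesis
    by (simp add: mult_ac)
qed

section \<open>The duality\<close>

text \<open>The sum of the line sums at \<beta> is \<open>q (n - card S) f \<beta>\<close> by the
  individual eigenvalues and \<open>q (n - h) f \<beta>\<close> by the total; \<open>q\<close> and
  \<open>f \<beta>\<close> are nonzero and cancel.\<close>

lemma eigenfunction_weight:
  assumes "S \<subseteq> {1..n}" "q \<ge> 1" "\<beta> \<in> carrier (hypercube q n)" "f \<beta> \<noteq> 0"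
    and "\<And>i \<beta>. i \<in> {1..n} \<Longrightarrow> \<beta> \<in> carrier (hypercube q n) \<Longrightarrow>
      line_sum q i f \<beta> = (if i \<in> S then 0 else of_nat q) * f \<beta>"
    and "(\<Sum>i\<in>{1..n}. line_sum q i f \<beta>) = of_nat q * (of_nat n - of_nat h) * f \<beta>"
  shows "card S = h"
proof -
  have "(\<Sum>i\<in>{1..n}. line_sum q i f \<beta>) = (\<Sum>i\<in>{1..n}. if i \<in> S then 0 else of_nat q * f \<beta>)"
    by (rule sum.cong) (auto simp: assms(3,5))
  also have "\<dots> = of_nat (card ({1..n} - S)) * (of_nat q * f \<beta>)"
    by (simp add: sum.If_cases Diff_eq)
  also have "card ({1..n} - S) = n - card S"
    using assms(1) by (simp add: card_Diff_subset finite_subset)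
  finally have "(of_nat (n - card S) :: complex) = of_nat n - of_nat h"
    using assms(2,4,6) by simp
  moreover have "card S \<le> n"
    using card_mono[OF _ assms(1)] by simp
  ultimately show ?thesis
    by (simp add: of_nat_diff)
qed

text \<open>Removing the common part \<open>J \<inter> S\<close> gives
  \<open>card S - card J = card (S - J) - card (J - S)\<close>. Thus a possibly negative exponent
  becomes a natural number once the factor from the enumerator is multiplied in.\<close>

lemma power_int_cancel_card:
  fixes A :: "'a :: field"
  assumes "A \<noteq> 0" "finite S" "finite J" "card S = h"
  shows "A powi (int h - int (card J)) * A ^ card (J - S) = A ^ card (S - J)"
proof -
  have "card (J - S) + card (J \<inter> S) = card J" "card (S - J) + card (J \<inter> S) = card S"
    using assms(2,3) card_Diff_subset_Int[of J S] card_Diff_subset_Int[of S J]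
      card_mono[of J "J \<inter> S"] card_mono[of S "J \<inter> S"] by (auto simp: Int_commute)
  then have "int h - int (card J) + int (card (J - S)) = int (card (S - J))"
    using assms(4) by linarith
  then show ?thesis
    using power_int_add[of A "int h - int (card J)" "int (card (J - S))"] assms(1) by simp
qed

lemma to_fract_power: "to_fract (p ^ k) = to_fract p ^ k"
  by (induction k) simp_all

theorem theorem1:
  fixes q n h :: nat
    and f :: "(nat \<Rightarrow> int) \<Rightarrow> complex"
    and \<alpha> :: "nat \<Rightarrow> int"
    and I :: "nat set"
  assumes "q \<ge> 2" and "n \<ge> 1" and "h \<in> {0..n}"
    and "lambda_function q n (of_int ((int q - 1) * int n - int q * int h)) f"
    and "\<alpha> \<in> carrier (hypercube q n)"
    and "I \<subseteq> {1..n}"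
  defines "J \<equiv> {1..n} - I"
    and "x' \<equiv> var_x + (of_nat q - 2) * var_y"
    and "y' \<equiv> - var_y"
  shows "to_fract (var_x + (of_nat q - 1) * var_y) powi (int h - int (card J))
           * to_fract (subst_xy (local_weight_enumerator q n f J \<alpha>) var_x var_y)
       = to_fract (x' + (of_nat q - 1) * y') powi (int h - int (card I))
           * to_fract (subst_xy (local_weight_enumerator q n f I \<alpha>) x' y')"
proof -
  have q: "q \<ge> 1"
    using assms(1) by simp
  have J: "J \<subseteq> {1..n}"
    by (auto simp: J_def)
  have fin: "finite I" "finite J"
    using assms(6) J finite_subset by blast+
  define A where "A = var_x + (of_nat q - 1) * var_y"
  define B where "B = var_x - var_y"
  have B': "x' + (of_nat q - 1) * y' = B" and A': "x' - y' = A"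
    by (simp_all add: x'_def y'_def A_def B_def algebra_simps)
  \<comment> \<open>The coefficient of \<open>x\<close> in \<open>y\<close>-degree 0 shows that both
    linear forms are nonzero, so their integer powers obey the exponent laws.\<close>
  have "coeff (coeff A 0) 1 = 1" "coeff (coeff B 0) 1 = 1"
    by (simp_all add: A_def B_def var_x_def var_y_def coeff_mult)
  then have nz: "to_fract A \<noteq> 0" "to_fract B \<noteq> 0"
    by auto
  \<comment> \<open>For fixed \<alpha> and \<open>I\<close> both sides are additive in
    \<open>g\<close>, as the induction rule requires.\<close>
  define P where "P g \<longleftrightarrow>
      to_fract A powi (int h - int (card J)) * to_fract (enumerator_at q n g J \<alpha> var_x var_y) =
      to_fract B powi (int h - int (card I)) * to_fract (enumerator_at q n g I \<alpha> x' y')" for g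
  have "P f"
  proof (rule eigenfunction_induct[where P = P and f = f and c = "of_nat q * (of_nat n - of_nat h)", OF q])
    fix g S
    assume S: "S \<subseteq> {1..n}"
      and eig: "\<And>i \<beta>. i \<in> {1..n} \<Longrightarrow> \<beta> \<in> carrier (hypercube q n) \<Longrightarrow>
        line_sum q i g \<beta> = (if i \<in> S then 0 else of_nat q) * g \<beta>"
      and tot: "\<And>\<beta>. \<beta> \<in> carrier (hypercube q n) \<Longrightarrow>
        (\<Sum>i\<in>{1..n}. line_sum q i g \<beta>) = of_nat q * (of_nat n - of_nat h) * g \<beta>"
    have gJ: "enumerator_at q n g J \<alpha> var_x var_y = bivar_const (g \<alpha>) * B ^ card (J \<inter> S) * A ^ card (J - S)"
      using enumerator_at_eigenfunction[OF q J assms(5) eig] by (simp add: A_def B_def)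
    have gI: "enumerator_at q n g I \<alpha> x' y' = bivar_const (g \<alpha>) * A ^ card (I \<inter> S) * B ^ card (I - S)"
      using enumerator_at_eigenfunction[OF q assms(6,5) eig] by (simp add: A' B')
    show "P g"
    \<comment> \<open>Both enumerators carry the factor \<open>g \<alpha>\<close>. If it vanishes,
      both sides are 0; otherwise \<alpha> itself is a point at which \<open>card S = h\<close> can
      be read off.\<close>
    proof (cases "g \<alpha> = 0")
      case True
      then show ?thesis
        by (simp add: P_def gI gJ)
    next
      case False
      have card: "card S = h"
        using eigenfunction_weight[OF S q assms(5) False eig tot[OF assms(5)]] .
      have "finite S"
        using S finite_subset by blast
      note cancel = power_int_cancel_card[OF nz(1) this fin(2) card] power_int_cancel_card[OF nz(2) this fin(1) card]
      \<comment> \<open>Complementation matches the exponents: both sides reduce to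
        \<open>g \<alpha>\<close> times \<open>B ^ card (J \<inter> S)\<close> and
        \<open>A ^ card (I \<inter> S)\<close>.\<close>
      have "S - J = I \<inter> S" "S - I = J \<inter> S"
        using S assms(6) by (auto simp: J_def)
      with cancel have a: "to_fract A powi (int h - int (card J)) * to_fract A ^ card (J - S) = to_fract A ^ card (I \<inter> S)"
        and b: "to_fract B powi (int h - int (card I)) * to_fract B ^ card (I - S) = to_fract B ^ card (J \<inter> S)"
        by simp_all
      let ?g = "to_fract (bivar_const (g \<alpha>))"
      have "to_fract A powi (int h - int (card J)) * to_fract (enumerator_at q n g J \<alpha> var_x var_y) =
          ?g * to_fract B ^ card (J \<inter> S) * to_fract A ^ card (I \<inter> S)"
        unfolding gJ to_fract_mult to_fract_power a[symmetric] by (simp only: mult_ac)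
      also have "\<dots> = to_fract B powi (int h - int (card I)) * to_fract (enumerator_at q n g I \<alpha> x' y')"
        unfolding gI to_fract_mult to_fract_power b[symmetric] by (simp only: mult_ac)
      finally show ?thesis
        unfolding P_def .
    qed
  next
    fix g\<^sub>1 g\<^sub>2
    assume "P g\<^sub>1" "P g\<^sub>2"
    then show "P (\<lambda>\<beta>. g\<^sub>1 \<beta> + g\<^sub>2 \<beta>)"
      by (simp add: P_def enumerator_at_add distrib_left)
  qed (rule lambda_function_line_sum[OF q assms(4)])
  then show ?thesis
    unfolding P_def B' A_def[symmetric]
    using subst_xy_local_weight_enumerator[OF q assms(5)] J assms(6) by simp
qed

end
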